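(* Let $\mathbf{r}_1,\mathbf{r}_2:[0,T]\to\mathbb{R}^2$ be contours with representations $\mathbf{q}_i=\mathbf{r}_i\sqrt{|\dot{\mathbf{r}}_i|}$, $i=1,2$. The reparameterization group $\Gamma$ acts by isometries with respect to the distance $d$: for every $\gamma\in\Gamma$, $$d^2(\mathbf{q}_1\circ\gamma,\mathbf{q}_2\circ\gamma)=d^2(\mathbf{q}_1,\mathbf{q}_2),$$ where $\mathbf{q}_i\circ\gamma$ denotes the representation of the reparameterized contour $t\mapsto\mathbf{r}_i(\gamma(t))$.
   Context: A contour is a closed planar curve given by a position vector $\mathbf{r}:[0,T]\to\mathbb{R}^2$ with $\mathbf{r}(0)=\mathbf{r}(T)$, twice continuously differentiable and with $\dot{\mathbf{r}}=d\mathbf{r}/dt$ nowhere zero. Its representation (position rescaled by square root velocity) is $\mathbf{q}(t)=\mathbf{r}(t)\sqrt{|\dot{\mathbf{r}}(t)|}$. The reparameterization group $\Gamma$ consists of the $C^2$ diffeomorphisms $\gamma:[0,T]\to[0,T]$ with $\gamma(0)=0$, $\gamma(T)=T$ and $\dot\gamma(t)>0$ for all $t$. The notation $\mathbf{q}\circ\gamma$ means the representation of the reparameterized contour $\mathbf{r}\circ\gamma$, i.e. $(\mathbf{q}\circ\gamma)(t)=\mathbf{r}(\gamma(t))\sqrt{|\mathbf{r}'(\gamma(t))|\,\dot\gamma(t)}$ with $\mathbf{r}'=d\mathbf{r}/d\gamma$ (it is not the plain composition of functions). The distance between representations is $d^2(\mathbf{q}_1,\mathbf{q}_2)=\int_0^T|\mathbf{q}_1(t)-\mathbf{q}_2(t)|^2\,dt$.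 *)

theory Defs
  imports "HOL-Analysis.Analysis"
begin

text \<open>
  Curves are total functions of which only the values on \<open>[0,T]\<close> matter; all derivatives
  are taken within \<open>{0..T}\<close>, hence one-sided at the two endpoints.
\<close>

definition C2_on :: "real set \<Rightarrow> (real \<Rightarrow> 'a::real_normed_vector) \<Rightarrow> bool" where
  "C2_on S f \<longleftrightarrow>
    (\<exists>f' f''. (\<forall>t\<in>S. (f has_vector_derivative f' t) (at t within S)) \<and>
              (\<forall>t\<in>S. (f' has_vector_derivative f'' t) (at t within S)) \<and>
              continuous_on S f'')"

definition velocity :: "real \<Rightarrow> (real \<Rightarrow> 'a::real_normed_vector) \<Rightarrow> real \<Rightarrow> 'a" where
  "velocity T f t = vector_derivative f (at t within {0..T})"

definition contour :: "real \<Rightarrow> (real \<Rightarrow> real^2) \<Rightarrow> bool" where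
  "contour T r \<longleftrightarrow> C2_on {0..T} r \<and> r 0 = r T \<and> (\<forall>t\<in>{0..T}. velocity T r t \<noteq> 0)"

definition representation :: "real \<Rightarrow> (real \<Rightarrow> real^2) \<Rightarrow> real \<Rightarrow> real^2" where
  "representation T r t = sqrt (norm (velocity T r t)) *\<^sub>R r t"

definition C2_diffeomorphism :: "real set \<Rightarrow> (real \<Rightarrow> real) \<Rightarrow> bool" where
  "C2_diffeomorphism S \<gamma> \<longleftrightarrow> bij_betw \<gamma> S S \<and> C2_on S \<gamma> \<and> C2_on S (inv_into S \<gamma>)"

definition reparam_group :: "real \<Rightarrow> (real \<Rightarrow> real) set" where
  "reparam_group T =
    {\<gamma>. C2_diffeomorphism {0..T} \<gamma> \<and> \<gamma> 0 = 0 \<and> \<gamma> T = T \<and> (\<forall>t\<in>{0..T}. velocity T \<gamma> t > 0)}"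

definition rep_dist :: "real \<Rightarrow> (real \<Rightarrow> real^2) \<Rightarrow> (real \<Rightarrow> real^2) \<Rightarrow> real" where
  "rep_dist T q1 q2 = sqrt (integral {0..T} (\<lambda>t. (norm (q1 t - q2 t))\<^sup>2))"

lemma C2_on_has_velocity:
  assumes "T > 0" "C2_on {0..T} f" "t \<in> {0..T}"
  shows "(f has_vector_derivative velocity T f t) (at t within {0..T})"
  using assms unfolding C2_on_def velocity_def
  by (metis vector_derivative_works differentiableI_vector)

lemma representation_reparam:
  assumes "T > 0" "contour T r" "\<gamma> \<in> reparam_group T" "t \<in> {0..T}"
  shows "representation T (r \<circ> \<gamma>) t =
           sqrt (norm (velocity T r (\<gamma> t)) * velocity T \<gamma> t) *\<^sub>R r (\<gamma> t)"
proof -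
  have g: "\<gamma> ` {0..T} = {0..T}" "C2_on {0..T} \<gamma>" "velocity T \<gamma> t > 0"
    using assms by (auto simp: reparam_group_def C2_diffeomorphism_def bij_betw_def)
  have "\<gamma> t \<in> {0..T}" using g(1) assms(4) by blast
  then have "(r has_vector_derivative velocity T r (\<gamma> t)) (at (\<gamma> t) within \<gamma> ` {0..T})"
    using C2_on_has_velocity assms(1,2) unfolding g(1) contour_def by blast
  then have "((r \<circ> \<gamma>) has_vector_derivative velocity T \<gamma> t *\<^sub>R velocity T r (\<gamma> t))
      (at t within {0..T})"
    using vector_diff_chain_within C2_on_has_velocity assms(1,4) g(2) by blast
  then have "velocity T (r \<circ> \<gamma>) t = velocity T \<gamma> t *\<^sub>R velocity T r (\<gamma> t)"
    using assms(1,4) unfolding velocity_def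
    by (metis atLeastAtMost_iff vector_derivative_within_cbox cbox_interval)
  then show ?thesis using g(3) by (simp add: representation_def mult.commute)
qed

end

theory Submission
  imports Defs
begin

text \<open>The square root in the representation makes q a half-density: reparameterizing by
  \<gamma> composes q with \<gamma> and multiplies it by the square root of the speed of \<gamma>
  (\<open>representation_comp\<close>). This factor is the same for both contours, so it comes out
  of the difference, and squaring turns it into the speed itself, which is the Jacobian in the
  change of variables s = \<gamma>(t). Continuity of the representations
  (\<open>continuous_on_representation\<close>) justifies the substitution.\<close>

text \<open>Derivatives within a nondegenerate interval are unique, so \<open>velocity\<close>
  agrees there with the witness \<open>f'\<close> from \<open>C2_on\<close>, which is continuous
  because it is differentiable.\<close>

lemma continuous_on_velocity:
  assumes "T > 0" "C2_on {0..T} f"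
  shows "continuous_on {0..T} (velocity T f)"
proof -
  obtain f' f'' where
    f': "\<And>t. t \<in> {0..T} \<Longrightarrow> (f has_vector_derivative f' t) (at t within {0..T})" and
    f'': "\<And>t. t \<in> {0..T} \<Longrightarrow> (f' has_vector_derivative f'' t) (at t within {0..T})"
    using assms(2) unfolding C2_on_def by blast
  have "continuous_on {0..T} f'"
    using f'' by (meson continuous_on_eq_continuous_within has_vector_derivative_continuous)
  moreover have "velocity T f t = f' t" if "t \<in> {0..T}" for t
    using f'[OF that] assms(1) that unfolding velocity_def
    by (metis atLeastAtMost_iff vector_derivative_within_cbox cbox_interval)
  ultimately show ?thesis
    using continuous_on_cong by metis
qed

lemma continuous_on_representation:
  assumes "T > 0" "contour T r"
  shows "continuous_on {0..T} (representation T r)"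
proof -
  have C2: "C2_on {0..T} r"
    using assms(2) by (simp add: contour_def)
  then have "continuous_on {0..T} r"
    using C2_on_has_velocity[OF assms(1)] has_vector_derivative_continuous
    by (metis continuous_on_eq_continuous_within)
  then show ?thesis
    unfolding representation_def
    by (intro continuous_intros continuous_on_velocity assms(1) C2)
qed

text \<open>Splitting the square root of the product isolates a scalar that depends on \<gamma>
  alone and not on the contour.\<close>

lemma representation_comp:
  assumes "T > 0" "contour T r" "\<gamma> \<in> reparam_group T" "t \<in> {0..T}"
  shows "representation T (r \<circ> \<gamma>) t = sqrt (velocity T \<gamma> t) *\<^sub>R representation T r (\<gamma> t)"
  using representation_reparam[OF assms]
  by (simp add: representation_def real_sqrt_mult mult.commute)

theorem mainTheorem1:
  fixes T :: real and r1 r2 :: "real \<Rightarrow> real^2"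
  assumes "T > 0"
    and "contour T r1"
    and "contour T r2"
  shows "\<forall>\<gamma>\<in>reparam_group T.
    (rep_dist T (representation T (r1 \<circ> \<gamma>)) (representation T (r2 \<circ> \<gamma>)))\<^sup>2 =
    (rep_dist T (representation T r1) (representation T r2))\<^sup>2"
proof
  fix \<gamma> assume \<gamma>: "\<gamma> \<in> reparam_group T"
  then have img: "\<gamma> ` {0..T} \<subseteq> {0..T}" and C2: "C2_on {0..T} \<gamma>"
    and ends: "\<gamma> 0 = 0" "\<gamma> T = T" and pos: "\<And>t. t \<in> {0..T} \<Longrightarrow> velocity T \<gamma> t > 0"
    by (auto simp: reparam_group_def C2_diffeomorphism_def bij_betw_def)
  define F where "F s = (norm (representation T r1 s - representation T r2 s))\<^sup>2" for s
  have "continuous_on {0..T} F"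
    unfolding F_def by (intro continuous_intros continuous_on_representation assms)
  moreover have "(\<gamma> has_real_derivative velocity T \<gamma> t) (at t within {0..T})"
    if "t \<in> {0..T}" for t
    using C2_on_has_velocity[OF assms(1) C2 that]
    by (simp add: has_real_derivative_iff_has_vector_derivative)
  \<comment> \<open>Substitution s = \<gamma>(t); since \<gamma> fixes both endpoints, the range of
    integration is again the whole interval.\<close>
  ultimately have "((\<lambda>t. velocity T \<gamma> t *\<^sub>R F (\<gamma> t)) has_integral integral {\<gamma> 0..\<gamma> T} F) {0..T}"
    using assms(1) img ends by (intro has_integral_substitution[where c = 0 and d = T]) auto
  then have "integral {0..T} (\<lambda>t. velocity T \<gamma> t *\<^sub>R F (\<gamma> t)) = integral {0..T} F"
    using ends by (simp add: integral_unique)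
  \<comment> \<open>Positivity of the speed of \<gamma> lets the square cancel the root of the
    common factor.\<close>
  moreover have "(norm (representation T (r1 \<circ> \<gamma>) t - representation T (r2 \<circ> \<gamma>) t))\<^sup>2
      = velocity T \<gamma> t *\<^sub>R F (\<gamma> t)" if "t \<in> {0..T}" for t
    using pos[OF that] that assms \<gamma>
    by (simp add: representation_comp F_def power_mult_distrib flip: scaleR_diff_right)
  ultimately have "integral {0..T}
      (\<lambda>t. (norm (representation T (r1 \<circ> \<gamma>) t - representation T (r2 \<circ> \<gamma>) t))\<^sup>2) = integral {0..T} F"
    by (metis (no_types, lifting) integral_cong)
  then show "(rep_dist T (representation T (r1 \<circ> \<gamma>)) (representation T (r2 \<circ> \<gamma>)))\<^sup>2 =
      (rep_dist T (representation T r1) (representation T r2))\<^sup>2"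
    by (simp add: rep_dist_def F_def[abs_def])
qed

end
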